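(* Consider $\min_{X\in\mathcal{M}} f(X)+g(AX)$ with $A\in\mathbb{R}^{d\times n}$, where: $\mathcal{M}$ is a compact Riemannian submanifold embedded in the Euclidean space $\mathbb{R}^{n\times r}$; $f:\mathcal{M}\to\mathbb{R}$ is smooth (not necessarily convex); $g:\mathbb{R}^{d\times r}\to\mathbb{R}$ is convex (possibly nonsmooth) and its subdifferentials $\partial g(Y)$ are bounded uniformly over all $Y\in\mathbb{R}^{d\times r}$. Let $\{W^k\}_{k\in\mathbb{N}}$, $W^k=[X^k;Y^k]$, be a sequence generated by the manifold inexact augmented Lagrangian method (MIALM, described in the context) with $\epsilon_{\min}=0$, and let $W^*=[X^*;Y^*]$ be a limit point of $\{W^k\}_{k\in\mathbb{N}}$. Suppose that for every $k$ the iterate $W^{k+1}$ is an $\epsilon_k$-global minimizer of the iteration subproblem, i.e. $$\mathcal{L}_{\rho_k}(W^{k+1};\bar Z^k)\le \mathcal{L}_{\rho_k}(W;\bar Z^k)+\epsilon_k\qquad\text{for all } W\in\mathcal{N}.$$ Then $W^*$ is a global minimizer of the problem $$\min_{X,Y}\ f(X)+g(Y)\quad\text{s.t. } AX=Y,\ X\in\mathcal{M},$$ and $X^*$ is a global minimizer of the problem $\min_{X\in\mathcal{M}} f(X)+g(AX)$.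
   Context: Notation. $\mathcal{N}=\mathcal{M}\times\mathbb{R}^{d\times r}$, $W=[X;Y]\in\mathcal{N}$. $\langle\cdot,\cdot\rangle$ and $\|\cdot\|_F$ are the Frobenius inner product and norm, and $\|M\|_\infty=\max_{i,j}|M_{ij}|$. $\mathrm{Prox}_{\mu g}(V)=\arg\min_Y\{g(Y)+\frac{1}{2\mu}\|Y-V\|_F^2\}$. A limit point means the limit of some subsequence. Augmented Lagrangian: $\mathcal{L}_\rho(W;Z)=\mathcal{L}_\rho(X,Y;Z)=f(X)+g(Y)-\langle Z,AX-Y\rangle+\frac{\rho}{2}\|AX-Y\|_F^2$. MIALM. Input: matrices $Z_{\min}<Z_{\max}$ in $\mathbb{R}^{d\times r}$ (entrywise), $X^0\in\mathcal{M}$, $Y^0\in\mathbb{R}^{d\times r}$, $\bar Z^0\in\mathbb{R}^{d\times r}$, $\rho_0>1$, $\sigma>1$, $0<\tau<1$, a lower bound $\epsilon_{\min}\ge 0$ for the tolerances, and positive tolerances $\{\epsilon_k\}_{k\in\mathbb{N}}$ decreasing to $0$ (consistent with $\epsilon_{\min}=0$). For $k=0,1,2,\dots$: (1) Let $\psi_k(X)=\inf_{Y\in\mathbb{R}^{d\times r}}\mathcal{L}_{\rho_k}(X,Y;\bar Z^k)$ for $X\in\mathcal{M}$. Compute $X^{k+1}\in\mathcal{M}$ by solving $\min_{X\in\mathcal{M}}\psi_k(X)$ inexactly with tolerance $\epsilon_k$ (the exact meaning of inexactness is the condition on $W^{k+1}$ stated in the claim), and set $Y^{k+1}=\mathrm{Prox}_{g/\rho_k}(AX^{k+1}-\frac{1}{\rho_k}\bar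 Z^k)$. (2) $Z^{k+1}=\bar Z^k-\rho_k(AX^{k+1}-Y^{k+1})$. (3) $\bar Z^{k+1}$ is the projection of $Z^{k+1}$ onto $\{Z: Z_{\min}\le Z\le Z_{\max}\}$ (entrywise inequalities). (4) $\rho_{k+1}=\rho_k$ if $\|AX^{k+1}-Y^{k+1}\|_\infty\le\tau\|AX^k-Y^k\|_\infty$, and $\rho_{k+1}=\sigma\rho_k$ otherwise. *)

theory Defs
  imports "HOL-Analysis.Analysis"
begin

text \<open>
  A matrix with rows indexed by \<open>'a\<close> and columns indexed by \<open>'b\<close> is an element of
  \<open>real ^ 'b ^ 'a\<close>; there \<open>\<bullet>\<close> and \<open>norm\<close> are the Frobenius inner product and norm.
\<close>

section \<open>Smoothness and embedded submanifolds\<close>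

text \<open>
  Class $C^k$ on an open set. The derivative is evaluated at a fixed direction so that the
  recursion stays within functions of one type; in finite dimension this is the usual notion.
\<close>

primrec Ck_on :: "nat \<Rightarrow> 'a::euclidean_space set \<Rightarrow> ('a \<Rightarrow> 'b::euclidean_space) \<Rightarrow> bool" where
  "Ck_on 0 S f \<longleftrightarrow> continuous_on S f"
| "Ck_on (Suc k) S f \<longleftrightarrow>
     (\<forall>x\<in>S. f differentiable (at x)) \<and>
     (\<forall>v. Ck_on k S (\<lambda>x. frechet_derivative f (at x) v))"

definition smooth_on :: "'a::euclidean_space set \<Rightarrow> ('a \<Rightarrow> 'b::euclidean_space) \<Rightarrow> bool" where
  "smooth_on S f \<longleftrightarrow> (\<forall>k. Ck_on k S f)"

text \<open>
  Slice charts: locally, a smooth diffeomorphism of the ambient space straightens \<open>M\<close> to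
  an \<open>m\<close>-dimensional linear subspace. The Riemannian metric of a Riemannian submanifold is the
  restriction of the ambient inner product to the tangent spaces, hence no extra datum.
\<close>

definition embedded_submanifold :: "nat \<Rightarrow> 'a::euclidean_space set \<Rightarrow> bool" where
  "embedded_submanifold m M \<longleftrightarrow>
     (\<forall>p\<in>M. \<exists>U V (\<phi> :: 'a \<Rightarrow> 'a) \<psi> S. open U \<and> p \<in> U \<and> open V \<and>
        homeomorphism U V \<phi> \<psi> \<and> smooth_on U \<phi> \<and> smooth_on V \<psi> \<and>
        subspace S \<and> dim S = m \<and> \<phi> ` (U \<inter> M) = V \<inter> S)"

text \<open>
  Smoothness of a function on an embedded submanifold, via local smooth extensions; only the
  values of \<open>f\<close> on \<open>M\<close> matter.
\<close>

definition smooth_on_submanifold :: "'a::euclidean_space set \<Rightarrow> ('a \<Rightarrow> real) \<Rightarrow> bool" where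
  "smooth_on_submanifold M f \<longleftrightarrow>
     (\<forall>p\<in>M. \<exists>U F. open U \<and> p \<in> U \<and> smooth_on U F \<and> (\<forall>x\<in>U \<inter> M. F x = f x))"

section \<open>Convex analysis\<close>

definition subdifferential :: "('a::real_inner \<Rightarrow> real) \<Rightarrow> 'a \<Rightarrow> 'a set" where
  "subdifferential g y = {G. \<forall>y'. g y' \<ge> g y + G \<bullet> (y' - y)}"

text \<open>
  \<open>prox \<mu> g V\<close> is $\mathrm{Prox}_{\mu g}(V)$; the minimizer exists and is unique for \<open>\<mu> > 0\<close> and
  \<open>g\<close> convex and finite.
\<close>

definition prox :: "real \<Rightarrow> ('a::real_inner \<Rightarrow> real) \<Rightarrow> 'a \<Rightarrow> 'a" where
  "prox \<mu> g V = arg_min (\<lambda>Y. g Y + 1 / (2 * \<mu>) * (norm (Y - V))\<^sup>2) (\<lambda>Y. True)"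

section \<open>The algorithm\<close>

definition max_norm :: "real ^ 'b ^ 'a \<Rightarrow> real" where
  "max_norm M = Max {\<bar>M $ i $ j\<bar> | i j. True}"

definition aug_lagrangian ::
  "(real ^ 'r ^ 'n \<Rightarrow> real) \<Rightarrow> (real ^ 'r ^ 'd \<Rightarrow> real) \<Rightarrow> real ^ 'n ^ 'd \<Rightarrow> real \<Rightarrow>
   real ^ 'r ^ 'n \<Rightarrow> real ^ 'r ^ 'd \<Rightarrow> real ^ 'r ^ 'd \<Rightarrow> real" where
  "aug_lagrangian f g A \<rho> X Y Z =
     f X + g Y - Z \<bullet> (A ** X - Y) + \<rho> / 2 * (norm (A ** X - Y))\<^sup>2"

text \<open>
  The strict order of \<open>real ^ 'r ^ 'd\<close> is not entrywise, so here and below entries are compared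
  explicitly.
\<close>

definition matrix_box :: "real ^ 'r ^ 'd \<Rightarrow> real ^ 'r ^ 'd \<Rightarrow> (real ^ 'r ^ 'd) set" where
  "matrix_box Zmin Zmax = {Z. \<forall>i j. Zmin $ i $ j \<le> Z $ i $ j \<and> Z $ i $ j \<le> Zmax $ i $ j}"

definition mialm_input ::
  "real ^ 'r ^ 'd \<Rightarrow> real ^ 'r ^ 'd \<Rightarrow> real \<Rightarrow> real \<Rightarrow> real \<Rightarrow> real \<Rightarrow> (nat \<Rightarrow> real) \<Rightarrow> bool" where
  "mialm_input Zmin Zmax \<rho>\<^sub>0 \<sigma> \<tau> \<epsilon>\<^sub>m\<^sub>i\<^sub>n \<epsilon> \<longleftrightarrow>
     (\<forall>i j. Zmin $ i $ j < Zmax $ i $ j) \<and>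
     \<rho>\<^sub>0 > 1 \<and> \<sigma> > 1 \<and> 0 < \<tau> \<and> \<tau> < 1 \<and>
     \<epsilon>\<^sub>m\<^sub>i\<^sub>n \<ge> 0 \<and> (\<forall>k. \<epsilon> k \<ge> \<epsilon>\<^sub>m\<^sub>i\<^sub>n) \<and>
     (\<forall>k. \<epsilon> k > 0) \<and> decseq \<epsilon> \<and> \<epsilon> \<longlonglongrightarrow> 0"

text \<open>
  All sequences a run produces, started at the arbitrary \<open>X 0 \<in> M\<close>, \<open>Y 0\<close>, \<open>Zbar 0\<close>
  (\<open>Z 0\<close> is never used). The criterion that \<open>X (Suc k)\<close> inexactly
  minimizes \<open>X \<mapsto> inf\<^sub>Y aug_lagrangian f g A (\<rho> k) X Y (Zbar k)\<close> over \<open>M\<close> is not part of this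
  predicate (the method leaves it open) and has to be imposed separately.
\<close>

definition mialm_run ::
  "(real ^ 'r ^ 'n) set \<Rightarrow> (real ^ 'r ^ 'd \<Rightarrow> real) \<Rightarrow> real ^ 'n ^ 'd \<Rightarrow>
   real ^ 'r ^ 'd \<Rightarrow> real ^ 'r ^ 'd \<Rightarrow> real \<Rightarrow> real \<Rightarrow> real \<Rightarrow>
   (nat \<Rightarrow> real ^ 'r ^ 'n) \<Rightarrow> (nat \<Rightarrow> real ^ 'r ^ 'd) \<Rightarrow>
   (nat \<Rightarrow> real ^ 'r ^ 'd) \<Rightarrow> (nat \<Rightarrow> real ^ 'r ^ 'd) \<Rightarrow> (nat \<Rightarrow> real) \<Rightarrow> bool" where
  "mialm_run M g A Zmin Zmax \<rho>\<^sub>0 \<sigma> \<tau> X Y Z Zbar \<rho> \<longleftrightarrow>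
     X 0 \<in> M \<and> \<rho> 0 = \<rho>\<^sub>0 \<and>
     (\<forall>k. X (Suc k) \<in> M \<and>
          Y (Suc k) = prox (1 / \<rho> k) g (A ** X (Suc k) - (1 / \<rho> k) *\<^sub>R Zbar k) \<and>
          Z (Suc k) = Zbar k - \<rho> k *\<^sub>R (A ** X (Suc k) - Y (Suc k)) \<and>
          Zbar (Suc k) = closest_point (matrix_box Zmin Zmax) (Z (Suc k)) \<and>
          \<rho> (Suc k) =
            (if max_norm (A ** X (Suc k) - Y (Suc k)) \<le> \<tau> * max_norm (A ** X k - Y k)
             then \<rho> k else \<sigma> * \<rho> k))"

definition limit_point :: "(nat \<Rightarrow> 'a::topological_space) \<Rightarrow> 'a \<Rightarrow> bool" where
  "limit_point W w \<longleftrightarrow> (\<exists>s. strict_mono s \<and> (W \<circ> s) \<longlonglongrightarrow> w)"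

end

theory Submission
  imports Defs
begin

text \<open>
  Along the subsequence that converges to \<open>(Xs, Ys)\<close>, the residual \<open>A ** X - Y\<close> converges to
  \<open>A ** Xs - Ys\<close>. Two points need an argument: this limit vanishes, and the objective value at the
  limit is minimal.

  The residual vanishes by the dichotomy of the penalty rule (\<open>penalty_rule_dichotomy\<close>).
  If the penalty is increased only finitely often, the residual eventually contracts by the factor
  \<open>\<tau>\<close>. Otherwise the penalty tends to infinity, and comparing the iterate \<open>(X, Y)\<close> with the
  feasible point \<open>(X, A ** X)\<close> bounds \<open>\<rho> / 2\<close> times the squared residual by a quantity that
  converges, because \<open>g\<close> is continuous and the multiplier terms are bounded.

  For minimality, the iterate is compared with an arbitrary feasible point, at which both the
  multiplier term and the penalty term are zero. At the iterate the penalty term is nonnegative,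
  and the multiplier term tends to zero since the safeguarded multipliers stay in a fixed bounded
  set (\<open>mialm_run_bounded_multipliers\<close>) while the residual vanishes. The tolerances tend
  to zero, so the limit of the comparison is the claim (\<open>limit_of_approximate_minimizers\<close>).
\<close>

section \<open>Continuity and matrix norms\<close>

lemma smooth_on_submanifold_imp_continuous_on:
  assumes "smooth_on_submanifold M f"
  shows "continuous_on M f"
  unfolding continuous_on_eq_continuous_within
proof
  fix p assume p: "p \<in> M"
  then obtain U F where U: "open U" "p \<in> U" "smooth_on U F" and eq: "\<forall>x\<in>U \<inter> M. F x = f x"
    using assms unfolding smooth_on_submanifold_def by blast
  have "continuous_on U F"
    using U(3) unfolding smooth_on_def by (metis Ck_on.simps(1))
  then have "continuous_on (U \<inter> M) f"
    using eq continuous_on_subset[of U F "U \<inter> M"] continuous_on_cong[of "U \<inter> M" "U \<inter> M" F f] by simp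
  then have "(f \<longlongrightarrow> f p) (at p within U \<inter> M)"
    using p U(2) by (simp add: continuous_on_def)
  moreover have "at p within U \<inter> M = at p within M"
    by (rule at_within_nhd[OF U(2,1)]) auto
  ultimately show "continuous (at p within M) f"
    by (simp add: continuous_within)
qed

lemma tendsto_matrix_mult_right:
  fixes A :: "real ^ 'n ^ 'd" and x :: "'a \<Rightarrow> real ^ 'r ^ 'n"
  assumes "(x \<longlongrightarrow> a) F"
  shows "((\<lambda>k. A ** x k) \<longlongrightarrow> A ** a) F"
  unfolding matrix_matrix_mult_def
  by (intro tendsto_vec_lambda tendsto_sum tendsto_mult tendsto_const tendsto_vec_nth assms)

lemma abs_entry_le_max_norm: "\<bar>R $ i $ j\<bar> \<le> max_norm R"
proof -
  have "{\<bar>R $ i $ j\<bar> | i j. True} = (\<lambda>(i, j). \<bar>R $ i $ j\<bar>) ` UNIV"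
    by auto
  then have "finite {\<bar>R $ i $ j\<bar> | i j. True}"
    by simp
  then show ?thesis
    unfolding max_norm_def by (rule Max_ge) blast
qed

lemma max_norm_nonneg: "0 \<le> max_norm R"
  using abs_entry_le_max_norm abs_ge_zero order_trans by blast

lemma tendsto_zero_of_max_norm:
  assumes "(\<lambda>k. max_norm (R k)) \<longlonglongrightarrow> 0"
  shows "R \<longlonglongrightarrow> 0"
proof (intro vec_tendstoI)
  fix i j
  show "(\<lambda>k. R k $ i $ j) \<longlonglongrightarrow> 0 $ i $ j"
    using Lim_null_comparison[OF _ assms, of "\<lambda>k. R k $ i $ j"]
    by (simp add: abs_entry_le_max_norm)
qed

section \<open>The multipliers and the penalty parameter\<close>

lemma matrix_box_eq_cbox: "matrix_box Zmin Zmax = cbox Zmin Zmax"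
  by (auto simp: matrix_box_def mem_box Basis_vec_def inner_axis)

lemma mialm_run_bounded_multipliers:
  assumes run: "mialm_run M g A Zmin Zmax \<rho>\<^sub>0 \<sigma> \<tau> X Y Z Zbar \<rho>"
    and box: "\<forall>i j. Zmin $ i $ j < Zmax $ i $ j"
  obtains B where "\<And>k. norm (Zbar k) \<le> B"
proof -
  have "Zmin \<in> matrix_box Zmin Zmax"
    using box by (simp add: matrix_box_def less_imp_le)
  then have *: "closest_point (matrix_box Zmin Zmax) (Z (Suc k)) \<in> cbox Zmin Zmax" for k
    using closest_point_in_set[of "matrix_box Zmin Zmax"] by (auto simp: matrix_box_eq_cbox)
  \<comment> \<open>The initial multiplier is arbitrary and need not lie in the box.\<close>
  have "Zbar k \<in> insert (Zbar 0) (cbox Zmin Zmax)" for k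
    using run * by (cases k) (auto simp: mialm_run_def)
  moreover have "bounded (insert (Zbar 0) (cbox Zmin Zmax))"
    by simp
  ultimately show thesis
    using that unfolding bounded_iff by blast
qed

text \<open>
  The penalty grows by the fixed factor \<open>\<sigma>\<close> whenever the residual measure \<open>r\<close> fails to
  contract, so infinitely many failures drive it to infinity, and finitely many failures mean
  that \<open>r\<close> eventually decays geometrically.
\<close>

lemma penalty_rule_dichotomy:
  fixes \<rho> r :: "nat \<Rightarrow> real"
  assumes pos: "\<rho> 0 > 0" and \<sigma>: "\<sigma> > 1" and \<tau>: "0 < \<tau>" "\<tau> < 1"
    and r: "\<And>k. r k \<ge> 0"
    and step: "\<And>k. \<rho> (Suc k) = (if r (Suc k) \<le> \<tau> * r k then \<rho> k else \<sigma> * \<rho> k)"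
  shows "(\<forall>k. \<rho> k > 0) \<and> (r \<longlonglongrightarrow> 0 \<or> filterlim \<rho> at_top sequentially)"
proof -
  have \<rho>_pos: "\<rho> k > 0" for k
    by (induction k) (use pos \<sigma> step in auto)
  have mono: "incseq \<rho>"
    using \<rho>_pos \<sigma> by (intro incseq_SucI) (simp add: step less_imp_le)
  have "r \<longlonglongrightarrow> 0 \<or> filterlim \<rho> at_top sequentially"
  proof (cases "\<exists>N. \<forall>k\<ge>N. r (Suc k) \<le> \<tau> * r k")
    case True
    then obtain N where N: "\<And>k. k \<ge> N \<Longrightarrow> r (Suc k) \<le> \<tau> * r k" by blast
    have bound: "r (k + N) \<le> \<tau> ^ k * r N" for k
    proof (induction k)
      case (Suc k)
      have "r (Suc k + N) \<le> \<tau> * r (k + N)" using N[of "k + N"] by simp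
      also have "\<dots> \<le> \<tau> * (\<tau> ^ k * r N)" using Suc \<tau> by simp
      finally show ?case by (simp add: mult.assoc)
    qed simp
    have "(\<lambda>k. \<tau> ^ k * r N) \<longlonglongrightarrow> 0"
      using \<tau> by (intro tendsto_mult_left_zero LIMSEQ_realpow_zero) auto
    then have "(\<lambda>k. r (k + N)) \<longlonglongrightarrow> 0"
      by (rule Lim_null_comparison[rotated]) (simp add: bound r)
    then show ?thesis using LIMSEQ_offset by blast
  next
    case False
    have large: "\<exists>k. \<rho> k \<ge> \<sigma> ^ n * \<rho> 0" for n
    proof (induction n)
      case (Suc n)
      then obtain k where k: "\<rho> k \<ge> \<sigma> ^ n * \<rho> 0" by blast
      obtain l where l: "l \<ge> k" "\<not> r (Suc l) \<le> \<tau> * r l" using False by blast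
      have "\<sigma> * (\<sigma> ^ n * \<rho> 0) \<le> \<sigma> * \<rho> l"
        using order_trans[OF k incseqD[OF mono l(1)]] \<sigma> by simp
      then show ?case using l(2) step[of l] by (auto intro!: exI[of _ "Suc l"] simp: mult.assoc)
    qed auto
    have "filterlim \<rho> at_top sequentially"
      unfolding filterlim_at_top
    proof
      fix C
      obtain n where "C / \<rho> 0 < \<sigma> ^ n" using real_arch_pow[OF \<sigma>] by blast
      then have "C \<le> \<sigma> ^ n * \<rho> 0" using pos by (simp add: pos_divide_less_eq)
      then obtain k where "C \<le> \<rho> k" using large[of n] order_trans by blast
      then show "\<forall>\<^sub>F j in sequentially. C \<le> \<rho> j"
        using mono unfolding eventually_sequentially by (meson incseqD order_trans)
    qed
    then show ?thesis ..
  qed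
  with \<rho>_pos show ?thesis
    by simp
qed

section \<open>Limits of approximate minimizers\<close>

lemma aug_lagrangian_feasible: "aug_lagrangian f g A \<rho> X (A ** X) Z = f X + g (A ** X)"
  by (simp add: aug_lagrangian_def)

lemma aug_lagrangian_lower_bound:
  assumes "norm Z \<le> B"
  shows "f X + g Y - B * norm (A ** X - Y) + \<rho> / 2 * (norm (A ** X - Y))\<^sup>2
           \<le> aug_lagrangian f g A \<rho> X Y Z"
proof -
  have "Z \<bullet> (A ** X - Y) \<le> B * norm (A ** X - Y)"
    by (rule order_trans[OF norm_cauchy_schwarz mult_right_mono[OF assms norm_ge_zero]])
  then show ?thesis
    unfolding aug_lagrangian_def by linarith
qed

text \<open>
  Testing the approximate minimality of \<open>(x k, y k)\<close> against \<open>(x k, A ** x k)\<close> cancels \<open>f\<close> and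
  leaves an upper bound on \<open>q k\<close> times the squared residual. The bound converges, so dividing it
  by \<open>q k\<close> gives zero in the limit.
\<close>

lemma feasible_limit_of_unbounded_penalty:
  fixes x :: "nat \<Rightarrow> real ^ 'r ^ 'n" and y z :: "nat \<Rightarrow> real ^ 'r ^ 'd"
  assumes x: "x \<longlonglongrightarrow> Xs" and y: "y \<longlonglongrightarrow> Ys" and e: "e \<longlonglongrightarrow> 0"
    and z: "\<And>k. norm (z k) \<le> B"
    and g: "continuous_on UNIV g"
    and q: "\<And>k. q k > 0" "filterlim q at_top sequentially"
    and min: "\<And>k. aug_lagrangian f g A (q k) (x k) (y k) (z k)
                  \<le> aug_lagrangian f g A (q k) (x k) (A ** x k) (z k) + e k"
  shows "A ** Xs = Ys"
proof -
  define D where "D k = g (A ** x k) - g (y k) + B * norm (A ** x k - y k) + e k" for k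
  note Ax = tendsto_matrix_mult_right[OF x, of A]
  have gAx: "(\<lambda>k. g (A ** x k)) \<longlonglongrightarrow> g (A ** Xs)"
    using continuous_on_tendsto_compose[OF g Ax] by simp
  have gy: "(\<lambda>k. g (y k)) \<longlonglongrightarrow> g Ys"
    using continuous_on_tendsto_compose[OF g y] by simp
  have "D \<longlonglongrightarrow> g (A ** Xs) - g Ys + B * norm (A ** Xs - Ys) + 0"
    unfolding D_def
    by (intro tendsto_mult tendsto_add tendsto_diff tendsto_norm tendsto_const gAx gy Ax y e)
  then have "(\<lambda>k. D k / q k) \<longlonglongrightarrow> 0"
    using q(2) by (intro tendsto_divide_0 filterlim_at_top_imp_at_infinity)
  moreover have "(norm (A ** x k - y k))\<^sup>2 / 2 \<le> D k / q k" for k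
  proof -
    have "q k / 2 * (norm (A ** x k - y k))\<^sup>2 \<le> D k"
      using min[of k] aug_lagrangian_lower_bound[OF z, of f "x k" g "y k" A "q k" k]
      unfolding aug_lagrangian_feasible D_def by linarith
    then show ?thesis
      using q(1)[of k] by (simp add: pos_le_divide_eq mult.commute)
  qed
  ultimately have "(\<lambda>k. (norm (A ** x k - y k))\<^sup>2 / 2) \<longlonglongrightarrow> 0"
    by (elim Lim_null_comparison[rotated]) simp
  moreover have "(\<lambda>k. (norm (A ** x k - y k))\<^sup>2 / 2) \<longlonglongrightarrow> (norm (A ** Xs - Ys))\<^sup>2 / 2"
    by (intro tendsto_divide tendsto_power tendsto_norm tendsto_diff tendsto_const Ax y) simp
  ultimately have "(norm (A ** Xs - Ys))\<^sup>2 / 2 = 0"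
    using LIMSEQ_unique by blast
  then show ?thesis by simp
qed

text \<open>
  At a feasible point the augmented Lagrangian is the objective. At \<open>(x k, y k)\<close> it is at least the
  objective minus \<open>B\<close> times the norm of the residual, an error that disappears in the limit.
\<close>

lemma limit_of_approximate_minimizers:
  fixes x :: "nat \<Rightarrow> real ^ 'r ^ 'n" and y z :: "nat \<Rightarrow> real ^ 'r ^ 'd"
  assumes x: "x \<longlonglongrightarrow> Xs" and y: "y \<longlonglongrightarrow> Ys" and e: "e \<longlonglongrightarrow> 0"
    and z: "\<And>k. norm (z k) \<le> B" and q: "\<And>k. q k > 0"
    and f: "(\<lambda>k. f (x k)) \<longlonglongrightarrow> f Xs" and g: "continuous_on UNIV g"
    and feasible: "A ** Xs = Ys"
    and min: "\<And>k. aug_lagrangian f g A (q k) (x k) (y k) (z k)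
                  \<le> aug_lagrangian f g A (q k) X' (A ** X') (z k) + e k"
  shows "f Xs + g Ys \<le> f X' + g (A ** X')"
proof (rule LIMSEQ_le)
  have gy: "(\<lambda>k. g (y k)) \<longlonglongrightarrow> g Ys"
    using continuous_on_tendsto_compose[OF g y] by simp
  have "(\<lambda>k. f (x k) + g (y k) - B * norm (A ** x k - y k))
          \<longlonglongrightarrow> f Xs + g Ys - B * norm (A ** Xs - Ys)"
    by (intro tendsto_add tendsto_diff tendsto_mult tendsto_norm tendsto_const f gy
        tendsto_matrix_mult_right x y)
  then show "(\<lambda>k. f (x k) + g (y k) - B * norm (A ** x k - y k)) \<longlonglongrightarrow> f Xs + g Ys"
    using feasible by simp
  show "(\<lambda>k. f X' + g (A ** X') + e k) \<longlonglongrightarrow> f X' + g (A ** X')"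
    using tendsto_add[OF tendsto_const e] by simp
  have "f (x k) + g (y k) - B * norm (A ** x k - y k) \<le> f X' + g (A ** X') + e k" for k
  proof -
    have "0 \<le> q k / 2 * (norm (A ** x k - y k))\<^sup>2"
      using q[of k] by simp
    then show ?thesis
      using min[of k] aug_lagrangian_lower_bound[OF z, of f "x k" g "y k" A "q k" k]
      unfolding aug_lagrangian_feasible by linarith
  qed
  then show "\<exists>N. \<forall>k\<ge>N. f (x k) + g (y k) - B * norm (A ** x k - y k)
                         \<le> f X' + g (A ** X') + e k"
    by blast
qed

section \<open>Global optimality of limit points\<close>

theorem theorem5p3:
  fixes M :: "(real ^ 'r ^ 'n) set"
    and f :: "real ^ 'r ^ 'n \<Rightarrow> real"
    and g :: "real ^ 'r ^ 'd \<Rightarrow> real"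
    and A :: "real ^ 'n ^ 'd"
    and Zmin Zmax :: "real ^ 'r ^ 'd"
    and \<rho>\<^sub>0 \<sigma> \<tau> \<epsilon>\<^sub>m\<^sub>i\<^sub>n :: real
    and \<epsilon> \<rho> :: "nat \<Rightarrow> real"
    and X :: "nat \<Rightarrow> real ^ 'r ^ 'n"
    and Y Z Zbar :: "nat \<Rightarrow> real ^ 'r ^ 'd"
    and Xs :: "real ^ 'r ^ 'n" and Ys :: "real ^ 'r ^ 'd"
    and m :: nat
  assumes "embedded_submanifold m M" and "compact M"
    and "smooth_on_submanifold M f"
    and "convex_on UNIV g"
    and "bounded (\<Union>V. subdifferential g V)"
    and "mialm_input Zmin Zmax \<rho>\<^sub>0 \<sigma> \<tau> \<epsilon>\<^sub>m\<^sub>i\<^sub>n \<epsilon>"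
    and "\<epsilon>\<^sub>m\<^sub>i\<^sub>n = 0"
    and "mialm_run M g A Zmin Zmax \<rho>\<^sub>0 \<sigma> \<tau> X Y Z Zbar \<rho>"
    and "limit_point (\<lambda>k. (X k, Y k)) (Xs, Ys)"
    and "\<And>k X' Y'. X' \<in> M \<Longrightarrow>
           aug_lagrangian f g A (\<rho> k) (X (Suc k)) (Y (Suc k)) (Zbar k)
             \<le> aug_lagrangian f g A (\<rho> k) X' Y' (Zbar k) + \<epsilon> k"
  shows "is_arg_min (\<lambda>(X, Y). f X + g Y) (\<lambda>(X, Y). A ** X = Y \<and> X \<in> M) (Xs, Ys)
       \<and> is_arg_min (\<lambda>X. f X + g (A ** X)) (\<lambda>X. X \<in> M) Xs"
proof -
  note run = \<open>mialm_run M g A Zmin Zmax \<rho>\<^sub>0 \<sigma> \<tau> X Y Z Zbar \<rho>\<close>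
  note input = \<open>mialm_input Zmin Zmax \<rho>\<^sub>0 \<sigma> \<tau> \<epsilon>\<^sub>m\<^sub>i\<^sub>n \<epsilon>\<close>
  note approx = assms(10)
  define r where "r k = max_norm (A ** X k - Y k)" for k
  have X_in: "X (Suc k) \<in> M" for k
    using run by (simp add: mialm_run_def)
  have "(\<forall>k. \<rho> k > 0) \<and> (r \<longlonglongrightarrow> 0 \<or> filterlim \<rho> at_top sequentially)"
    using penalty_rule_dichotomy[of \<rho> \<sigma> \<tau> r] run input
    by (simp add: mialm_run_def mialm_input_def r_def max_norm_nonneg)
  then have \<rho>_pos: "\<And>k. \<rho> k > 0" and dich: "r \<longlonglongrightarrow> 0 \<or> filterlim \<rho> at_top sequentially"
    by auto
  obtain B where B: "\<And>k. norm (Zbar k) \<le> B"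
    using mialm_run_bounded_multipliers[OF run] input by (auto simp: mialm_input_def)
  have g_cont: "continuous_on UNIV g"
    using \<open>convex_on UNIV g\<close> by (simp add: convex_on_continuous)

  obtain s where s: "strict_mono s" "((\<lambda>k. (X k, Y k)) \<circ> s) \<longlonglongrightarrow> (Xs, Ys)"
    using \<open>limit_point _ _\<close> unfolding limit_point_def by blast
  \<comment> \<open>The minimality of the iterate \<open>Suc k\<close> involves the parameters of step \<open>k\<close>, so the
    subsequence is written as \<open>Suc \<circ> t\<close>, dropping its first term to avoid the index zero.\<close>
  define t where "t k = s (Suc k) - 1" for k
  have s_gt: "s (Suc k) > s k" for k
    using s(1) by (simp add: strict_monoD)
  then have Suc_t: "Suc (t k) = s (Suc k)" for k
    by (metis Suc_pred' t_def bot_nat_0.not_eq_extremum not_less_zero)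
  have "strict_mono t"
    using s_gt Suc_t by (intro strict_monoI_Suc) (metis Suc_less_eq)
  then have t: "filterlim t at_top sequentially"
    by (rule filterlim_subseq)
  have XY: "(\<lambda>k. (X (Suc (t k)), Y (Suc (t k)))) \<longlonglongrightarrow> (Xs, Ys)"
    using LIMSEQ_Suc[OF s(2)] by (simp add: Suc_t o_def)
  have x: "(\<lambda>k. X (Suc (t k))) \<longlonglongrightarrow> Xs" and y: "(\<lambda>k. Y (Suc (t k))) \<longlonglongrightarrow> Ys"
    using tendsto_fst[OF XY] tendsto_snd[OF XY] by simp_all
  have e: "(\<lambda>k. \<epsilon> (t k)) \<longlonglongrightarrow> 0"
    using input t unfolding mialm_input_def by (blast intro: filterlim_compose)
  have Xs_in: "Xs \<in> M"
    using closed_sequentially[OF compact_imp_closed[OF \<open>compact M\<close>] _ x] X_in by blast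
  have f: "(\<lambda>k. f (X (Suc (t k)))) \<longlonglongrightarrow> f Xs"
    using continuous_on_tendsto_compose[OF smooth_on_submanifold_imp_continuous_on x Xs_in]
      \<open>smooth_on_submanifold M f\<close> X_in by simp

  have feasible: "A ** Xs = Ys"
    using dich
  proof
    assume "r \<longlonglongrightarrow> 0"
    then have "(\<lambda>k. r (Suc (t k))) \<longlonglongrightarrow> 0"
      by (rule filterlim_compose) (rule filterlim_compose[OF filterlim_Suc t])
    then have "(\<lambda>k. A ** X (Suc (t k)) - Y (Suc (t k))) \<longlonglongrightarrow> 0"
      unfolding r_def by (rule tendsto_zero_of_max_norm)
    moreover have "(\<lambda>k. A ** X (Suc (t k)) - Y (Suc (t k))) \<longlonglongrightarrow> A ** Xs - Ys"
      by (intro tendsto_diff tendsto_matrix_mult_right x y)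
    ultimately show ?thesis
      using LIMSEQ_unique by fastforce
  next
    assume "filterlim \<rho> at_top sequentially"
    then have "filterlim (\<lambda>k. \<rho> (t k)) at_top sequentially"
      using t by (rule filterlim_compose)
    then show ?thesis
      by (rule feasible_limit_of_unbounded_penalty[OF x y e B g_cont \<rho>_pos])
         (rule approx[OF X_in])
  qed
  have optimal: "f Xs + g Ys \<le> f X' + g (A ** X')" if "X' \<in> M" for X'
    by (rule limit_of_approximate_minimizers[OF x y e B \<rho>_pos f g_cont feasible])
       (rule approx[OF that])
  show ?thesis
    using optimal Xs_in feasible by (force simp: is_arg_min_linorder)
qed

end
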